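(* Let $X$ be a convex, compact and non-empty subset of $\mathbb{R}^n$, and let $\succeq$ be a binary relation on $\mathbb{R}^n$. If $\succeq$ is continuous and convex$^s$, then there exists at least one maximal element for $\succeq$ on $X$.
   Context: For a binary relation $\succeq$ on $\mathbb{R}^n$ (no further properties such as completeness, transitivity or reflexivity are assumed), its asymmetric part $\succ$ is defined by: $x\succ y$ if and only if $x\succeq y$ and not $y\succeq x$. Put $U^s(x)=\{y\in\mathbb{R}^n : y\succ x\}$ and $L^s(x)=\{y\in\mathbb{R}^n : x\succ y\}$. The relation $\succeq$ is upper (resp. lower) semicontinuous if $L^s(x)$ (resp. $U^s(x)$) is open in $\mathbb{R}^n$ for every $x\in\mathbb{R}^n$; it is continuous if it is both upper and lower semicontinuous. It is convex$^s$ if $U^s(x)$ is convex for every $x\in\mathbb{R}^n$. A point $\hat x\in X$ is a maximal element for $\succeq$ on $X$ if there is no $y\in X$ with $y\succ\hat x$. *)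

theory Defs
  imports "HOL-Analysis.Analysis"
begin

text \<open>
  A binary relation is a predicate \<open>R\<close>, where \<open>R x y\<close> reads ``\<open>x\<close> is weakly preferred to \<open>y\<close>''.
  No reflexivity, transitivity or completeness is assumed anywhere.
\<close>

definition strict :: "('a \<Rightarrow> 'a \<Rightarrow> bool) \<Rightarrow> 'a \<Rightarrow> 'a \<Rightarrow> bool" where
  "strict R x y \<longleftrightarrow> R x y \<and> \<not> R y x"

definition upper_strict :: "('a \<Rightarrow> 'a \<Rightarrow> bool) \<Rightarrow> 'a \<Rightarrow> 'a set" where
  "upper_strict R x = {y. strict R y x}"

definition lower_strict :: "('a \<Rightarrow> 'a \<Rightarrow> bool) \<Rightarrow> 'a \<Rightarrow> 'a set" where
  "lower_strict R x = {y. strict R x y}"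

text \<open>
  Upper semicontinuity is openness of the strict \<^emph>\<open>lower\<close> sections, and lower semicontinuity
  is openness of the strict \<^emph>\<open>upper\<close> sections.
\<close>

definition upper_semicontinuous_rel :: "('a::topological_space \<Rightarrow> 'a \<Rightarrow> bool) \<Rightarrow> bool" where
  "upper_semicontinuous_rel R \<longleftrightarrow> (\<forall>x. open (lower_strict R x))"

definition lower_semicontinuous_rel :: "('a::topological_space \<Rightarrow> 'a \<Rightarrow> bool) \<Rightarrow> bool" where
  "lower_semicontinuous_rel R \<longleftrightarrow> (\<forall>x. open (upper_strict R x))"

definition continuous_rel :: "('a::topological_space \<Rightarrow> 'a \<Rightarrow> bool) \<Rightarrow> bool" where
  "continuous_rel R \<longleftrightarrow> upper_semicontinuous_rel R \<and> lower_semicontinuous_rel R"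

text \<open>The suffix \<open>s\<close> refers to the strict upper sections; it does not mean strict convexity.\<close>

definition convex_s_rel :: "('a::real_vector \<Rightarrow> 'a \<Rightarrow> bool) \<Rightarrow> bool" where
  "convex_s_rel R \<longleftrightarrow> (\<forall>x. convex (upper_strict R x))"

definition maximal_element :: "('a \<Rightarrow> 'a \<Rightarrow> bool) \<Rightarrow> 'a set \<Rightarrow> 'a \<Rightarrow> bool" where
  "maximal_element R X x \<longleftrightarrow> x \<in> X \<and> \<not> (\<exists>y\<in>X. strict R y x)"

end

theory Submission
  imports Defs
begin

text \<open>
  If no point of the domain is maximal, finitely many of the open strict lower sections cover
  it by compactness. A partition of unity subordinate to this cover yields a continuous self-map
  that sends each point to a convex combination of points strictly preferred to it, so by
  convexity of the upper sections Brouwer's fixed point is strictly preferred to itself.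
\<close>

lemma exists_avoiding_open_sections:
  fixes X :: "'a::euclidean_space set" and L :: "'a \<Rightarrow> 'a set"
  assumes X: "convex X" "compact X" "X \<noteq> {}"
    and op: "\<And>y. y \<in> X \<Longrightarrow> open (L y)"
    and cv: "\<And>x. x \<in> X \<Longrightarrow> convex {y. x \<in> L y}"
    and irr: "\<And>x. x \<in> X \<Longrightarrow> x \<notin> L x"
  shows "\<exists>x\<in>X. \<forall>y\<in>X. x \<notin> L y"
proof (rule ccontr)
  assume "\<not> ?thesis"
  then have "X \<subseteq> (\<Union>y\<in>X. L y)" by blast
  then obtain Y where Y: "Y \<subseteq> X" "finite Y" "X \<subseteq> (\<Union>y\<in>Y. L y)"
    using compactE_image[OF X(2), of X L] op by blast
  \<comment> \<open>Distances to the complements of the covering sets, divided by their sum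
    \<open>s\<close>, form the partition of unity; \<open>f\<close> averages the points of
    \<open>Y\<close> with these weights.\<close>
  define g where "g y x = infdist x (- L y)" for y x
  define s where "s x = (\<Sum>y\<in>Y. g y x)" for x
  define f where "f x = (\<Sum>y\<in>Y. (g y x / s x) *\<^sub>R y)" for x
  have g0: "g y x \<ge> 0" for y x
    by (simp add: g_def infdist_nonneg)
  have g_pos: "g y x > 0 \<longleftrightarrow> x \<in> L y" if "y \<in> Y" for x y
  proof -
    \<comment> \<open>Nonemptiness matters because \<open>infdist\<close> to the empty set is 0 by
      convention; irreflexivity puts \<open>y\<close> itself in the complement of
      \<open>L y\<close>.\<close>
    have "closed (- L y)" "- L y \<noteq> {}"
      using op irr Y(1) that by auto
    then have "x \<in> - L y \<longleftrightarrow> g y x = 0"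
      unfolding g_def by (rule in_closed_iff_infdist_zero)
    then show ?thesis using g0[of y x] by auto
  qed
  have s_pos: "s x > 0" if x: "x \<in> X" for x
  proof -
    obtain y where "y \<in> Y" "x \<in> L y" using Y(3) x by blast
    then show ?thesis
      unfolding s_def using g_pos g0 Y(2) by (intro sum_pos2[of Y y]) auto
  qed
  have weights: "(\<Sum>y\<in>Y. g y x / s x) = 1" if "x \<in> X" for x
    using s_pos[OF that] by (simp add: sum_divide_distrib[symmetric] s_def[symmetric])
  have "continuous_on X f"
    unfolding f_def s_def g_def
    using s_pos by (intro continuous_intros) (force simp: s_def g_def)
  moreover have "f \<in> X \<rightarrow> X"
  proof
    fix x assume "x \<in> X"
    with weights Y g0 s_pos show "f x \<in> X"
      unfolding f_def by (intro convex_sum X(1)) (auto simp: less_imp_le)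
  qed
  ultimately obtain x where x: "x \<in> X" "f x = x"
    using brouwer[OF X(2,1,3)] by blast
  define Z where "Z = {y \<in> Y. x \<in> L y}"
  have "Z \<subseteq> Y" "\<And>y. y \<in> Y - Z \<Longrightarrow> g y x = 0"
    using g_pos[of _ x] g0[of _ x] by (fastforce simp: Z_def less_le)+
  then have "f x = (\<Sum>y\<in>Z. (g y x / s x) *\<^sub>R y)"
    and "(\<Sum>y\<in>Y. g y x / s x) = (\<Sum>y\<in>Z. g y x / s x)"
    unfolding f_def using Y(2) by (intro sum.mono_neutral_right; auto)+
  then have "f x = (\<Sum>y\<in>Z. (g y x / s x) *\<^sub>R y)" and "(\<Sum>y\<in>Z. g y x / s x) = 1"
    using weights[OF x(1)] by simp_all
  \<comment> \<open>All of \<open>Z\<close> lies in the convex set \<open>{y. x \<in> L y}\<close>,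
    hence so does the average, which is \<open>x\<close> itself: this says
    \<open>x \<in> L x\<close>.\<close>
  moreover have "(\<Sum>y\<in>Z. (g y x / s x) *\<^sub>R y) \<in> {y. x \<in> L y}"
    using calculation(2) Y(2) g0 s_pos[OF x(1)]
    by (intro convex_sum cv x(1)) (auto simp: Z_def less_imp_le)
  ultimately show False
    using x irr by simp
qed

theorem theorem3p12:
  fixes X :: "(real ^ 'n) set" and R :: "real ^ 'n \<Rightarrow> real ^ 'n \<Rightarrow> bool"
  assumes "convex X" and "compact X" and "X \<noteq> {}"
    and "continuous_rel R" and "convex_s_rel R"
  shows "\<exists>x. maximal_element R X x"
proof -
  \<comment> \<open>Take \<open>L\<close> to be \<open>lower_strict R\<close>: its transposed
    sections are the sets \<open>upper_strict R x\<close>, and asymmetry of \<open>strict R\<close>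
    gives irreflexivity.\<close>
  have "\<exists>x\<in>X. \<forall>y\<in>X. x \<notin> lower_strict R y"
  proof (rule exists_avoiding_open_sections[OF assms(1-3)])
    show "open (lower_strict R y)" for y
      using assms(4) by (simp add: continuous_rel_def upper_semicontinuous_rel_def)
    show "convex {y. x \<in> lower_strict R y}" for x
      using assms(5) by (simp add: convex_s_rel_def upper_strict_def lower_strict_def)
    show "x \<notin> lower_strict R x" for x
      by (simp add: lower_strict_def strict_def)
  qed
  then show ?thesis
    by (auto simp: maximal_element_def lower_strict_def)
qed

end
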